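(* Let $\theta\in(0,\pi)$ be such that $\tau=\tan(\theta/2)\in\mathbb{Q}_{>0}$. Suppose $x,y\in\mathbb{Q}_{>0}$ satisfy $xy=\tau(x+y)+1$, and define $a=y+\tau^{-1}$, $b=x+\tau^{-1}$, $c=x+y$. Then there is a Heron triangle with side lengths $a,b,c$ having angle $\theta$ between the sides of lengths $a$ and $b$, and its area $n=\frac12 ab\sin\theta$ (the corresponding $\tau$-congruent number) satisfies $n\equiv \tau xy \pmod{(\mathbb{Q}^{\times})^{2}}$, i.e. $n/(\tau xy)$ is the square of a nonzero rational number.
   Context: A Heron triangle is a non-degenerate triangle with rational side lengths and rational area. For $\tau=\tan(\theta/2)\in\mathbb{Q}_{>0}$, a number $n$ is a $\tau$-congruent number if it is the area of a triangle with rational side lengths having an angle equal to $\theta$; equivalently $n=\frac12 ab\sin\theta=\frac{ab\tau}{1+\tau^2}$ for some positive rationals $a,b$. *)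

theory Defs
  imports "HOL-Analysis.Analysis"
begin

definition triangle_area :: "real^2 \<Rightarrow> real^2 \<Rightarrow> real^2 \<Rightarrow> real" where
  "triangle_area A B C = measure lborel (convex hull {A, B, C})"

(* The angle at the middle argument Q between the rays QP and QR, with values in [0, pi].
   It is only meaningful for P \<noteq> Q and R \<noteq> Q. *)
definition vertex_angle :: "real^2 \<Rightarrow> real^2 \<Rightarrow> real^2 \<Rightarrow> real" where
  "vertex_angle P Q R = arccos (((P - Q) \<bullet> (R - Q)) / (norm (P - Q) * norm (R - Q)))"

definition rational_triangle :: "real^2 \<Rightarrow> real^2 \<Rightarrow> real^2 \<Rightarrow> bool" where
  "rational_triangle A B C \<longleftrightarrow>
     \<not> collinear {A, B, C} \<and> dist B C \<in> \<rat> \<and> dist A C \<in> \<rat> \<and> dist A B \<in> \<rat>"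

definition heron_triangle :: "real^2 \<Rightarrow> real^2 \<Rightarrow> real^2 \<Rightarrow> bool" where
  "heron_triangle A B C \<longleftrightarrow> rational_triangle A B C \<and> triangle_area A B C \<in> \<rat>"

(* The vertices are unordered, so the vertex with angle \<theta> may be called C. *)
definition tau_congruent :: "real \<Rightarrow> real \<Rightarrow> bool" where
  "tau_congruent \<tau> n \<longleftrightarrow>
     \<tau> \<in> \<rat> \<and> \<tau> > 0 \<and>
     (\<exists>\<theta> A B C. 0 < \<theta> \<and> \<theta> < pi \<and> tan (\<theta> / 2) = \<tau> \<and>
        rational_triangle A B C \<and> vertex_angle A C B = \<theta> \<and> triangle_area A B C = n)"

(* Equality of the classes of m and n in the quotient of the multiplicative group of
   the rationals by its subgroup of squares. *)
definition cong_mod_squares :: "real \<Rightarrow> real \<Rightarrow> bool" where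
  "cong_mod_squares m n \<longleftrightarrow>
     m \<in> \<rat> \<and> m \<noteq> 0 \<and> n \<in> \<rat> \<and> n \<noteq> 0 \<and> (\<exists>q\<in>\<rat>. q \<noteq> 0 \<and> m / n = q\<^sup>2)"

end

theory Submission
  imports Defs
begin

text \<open>Put \<open>z = 1 / \<tau>\<close>. The hypothesis on \<open>x\<close> and \<open>y\<close> is \<open>x y z = x + y + z\<close>: it says that the
  triangle with tangent lengths \<open>x\<close>, \<open>y\<close>, \<open>z\<close>, i.e. with sides \<open>y + z\<close>, \<open>x + z\<close>, \<open>x + y\<close>, has
  inradius 1, so that its angle at the vertex with tangent length \<open>z\<close> satisfies
  \<open>tan (\<theta> / 2) = 1 / z = \<tau>\<close>. Its area is inradius times semiperimeter,
  \<open>x + y + z = x y / \<tau>\<close>, which differs from \<open>\<tau> x y\<close> by the square of \<open>1 / \<tau>\<close>.\<close>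

text \<open>Put \<open>C\<close> at the origin, \<open>A\<close> on the positive first axis and
  \<open>B\<close> at polar angle \<open>\<theta>\<close>. The third side is left squared, as in the
  law of cosines, so that it can be matched with a prescribed length later.\<close>

lemma exists_triangle_two_sides_angle:
  fixes a b \<theta> :: real
  assumes "a > 0" "b > 0" "0 < \<theta>" "\<theta> < pi"
  obtains A B C :: "real^2" where
    "\<not> collinear {A, B, C}" "dist B C = a" "dist A C = b"
    "(dist A B)\<^sup>2 = a\<^sup>2 + b\<^sup>2 - 2 * a * b * cos \<theta>"
    "vertex_angle A C B = \<theta>" "triangle_area A B C = 1 / 2 * a * b * sin \<theta>"
proof -
  define A B :: "real^2" where "A = vector [b, 0]" and "B = vector [a * cos \<theta>, a * sin \<theta>]"
  have sin_pos: "sin \<theta> > 0"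
    using assms by (intro sin_gt_zero)
  have comp: "A $ 1 = b" "A $ 2 = 0" "B $ 1 = a * cos \<theta>" "B $ 2 = a * sin \<theta>"
    by (simp_all add: A_def B_def)
  have inner: "A \<bullet> A = b\<^sup>2" "B \<bullet> B = a\<^sup>2" "A \<bullet> B = a * b * cos \<theta>"
    using sin_cos_squared_add[of \<theta>]
    by (simp_all add: inner_vec_def sum_2 comp power2_eq_square)
       (simp add: algebra_simps flip: distrib_left power2_eq_square)
  have norms: "norm A = b" "norm B = a"
    using assms by (simp_all add: norm_eq_sqrt_inner inner)
  show thesis
  proof (rule that[of A B 0])
    have "A \<noteq> 0"
      using norms assms by auto
    \<comment> \<open>The second coordinate of \<open>B\<close> is positive, while every multiple of
      \<open>A\<close> has second coordinate 0.\<close>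
    moreover have "B \<noteq> k *\<^sub>R A" for k
    proof -
      have "B $ 2 \<noteq> (k *\<^sub>R A) $ 2"
        using comp assms sin_pos by simp
      then show ?thesis
        by metis
    qed
    ultimately show "\<not> collinear {A, B, 0}"
      using collinear_lemma[of A B] norms assms by (auto simp: insert_commute)
    show "dist B 0 = a" "dist A 0 = b"
      by (simp_all add: norms)
    show "(dist A B)\<^sup>2 = a\<^sup>2 + b\<^sup>2 - 2 * a * b * cos \<theta>"
      by (simp add: dist_norm power2_norm_eq_inner inner_diff_left inner_diff_right
          inner inner_commute[of B A])
    show "vertex_angle A 0 B = \<theta>"
      using assms by (simp add: vertex_angle_def inner norms arccos_cos)
    \<comment> \<open>Half the absolute value of a determinant; since \<open>A $ 2 = 0\<close>, only
      the product \<open>b * (a * sin \<theta>)\<close> survives, and it is positive.\<close>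
    show "triangle_area A B 0 = 1 / 2 * a * b * sin \<theta>"
      using assms sin_pos by (simp add: triangle_area_def content_triangle comp abs_mult)
  qed
qed

theorem theorem2p3:
  fixes \<theta> \<tau> x y a b c n :: real
  assumes "0 < \<theta>" and "\<theta> < pi"
    and "\<tau> = tan (\<theta> / 2)" and "\<tau> \<in> \<rat>" and "\<tau> > 0"
    and "x \<in> \<rat>" and "x > 0" and "y \<in> \<rat>" and "y > 0"
    and "x * y = \<tau> * (x + y) + 1"
    and "a = y + inverse \<tau>" and "b = x + inverse \<tau>" and "c = x + y"
    and "n = 1 / 2 * a * b * sin \<theta>"
  shows "(\<exists>A B C. heron_triangle A B C \<and>
            dist B C = a \<and> dist A C = b \<and> dist A B = c \<and>
            vertex_angle A C B = \<theta> \<and> triangle_area A B C = n) \<and>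
         tau_congruent \<tau> n \<and>
         cong_mod_squares n (\<tau> * x * y)"
proof -
  have pos: "a > 0" "b > 0" "c > 0"
    using assms by (simp_all add: add_pos_pos)
  have rat: "a \<in> \<rat>" "b \<in> \<rat>" "c \<in> \<rat>"
    using assms by auto
  have nz: "1 + \<tau>\<^sup>2 \<noteq> 0"
    by (metis add_pos_nonneg less_irrefl zero_le_power2 zero_less_one)
  have "cos (\<theta> / 2) \<noteq> 0"
    using assms cos_gt_zero[of "\<theta> / 2"] by auto
  then have cos: "cos \<theta> = (1 - \<tau>\<^sup>2) / (1 + \<tau>\<^sup>2)"
    using cos_tan_half[of "\<theta> / 2"] assms by simp
  have sin: "sin \<theta> = 2 * \<tau> / (1 + \<tau>\<^sup>2)"
    using sin_tan_half[of "\<theta> / 2"] assms by simp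
  have a_tau: "a * \<tau> = y * \<tau> + 1" and b_tau: "b * \<tau> = x * \<tau> + 1"
    using assms by (simp_all add: field_simps)
  \<comment> \<open>The factor \<open>\<tau>\<close> clears the inverses in \<open>a\<close> and
    \<open>b\<close>. In the expanded product, \<open>\<tau> * (x + y) + 1\<close> is
    \<open>x * y\<close> by hypothesis.\<close>
  have "\<tau>\<^sup>2 * (a * b) = (a * \<tau>) * (b * \<tau>)"
    by (simp add: power2_eq_square)
  also have "\<dots> = (1 + \<tau>\<^sup>2) * (x * y)"
    unfolding a_tau b_tau using \<open>x * y = \<tau> * (x + y) + 1\<close> by algebra
  finally have ab: "a * b = (1 + \<tau>\<^sup>2) * (x * y) / \<tau>\<^sup>2"
    using \<open>\<tau> > 0\<close> by (simp add: field_simps)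
  have "n = a * b * \<tau> / (1 + \<tau>\<^sup>2)"
    using assms sin by simp
  also have "\<dots> = x * y / \<tau>"
    unfolding ab using nz \<open>\<tau> > 0\<close> by (simp add: power2_eq_square)
  finally have n: "n = x * y / \<tau>" .
  \<comment> \<open>The law of cosines is checked in the form \<open>(a + b)\<^sup>2 - c\<^sup>2 = 2
    * (a * b) * (1 + cos \<theta>)\<close>, whose two sides are computed separately.\<close>
  have "2 * (a * b) * (1 + cos \<theta>) = 4 * (x * y) / \<tau>\<^sup>2"
  proof -
    have "1 + cos \<theta> = 2 / (1 + \<tau>\<^sup>2)"
      unfolding cos using nz by (simp add: field_simps)
    then show ?thesis
      unfolding ab using nz by simp
  qed
  moreover have "(a + b)\<^sup>2 - c\<^sup>2 = 4 * (x * y) / \<tau>\<^sup>2"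
  proof -
    have "(a + b)\<^sup>2 - c\<^sup>2 = (a + b - c) * (a + b + c)"
      by (simp add: algebra_simps power2_eq_square)
    \<comment> \<open>The factors are \<open>2 / \<tau>\<close> and
      \<open>2 * (x + y + 1 / \<tau>)\<close>, twice a tangent length and the perimeter.\<close>
    also have "\<dots> = 4 * (\<tau> * (x + y) + 1) / \<tau>\<^sup>2"
      using assms(5) unfolding assms(11-13) by (simp add: field_simps power2_eq_square)
    finally show ?thesis
      using assms by simp
  qed
  ultimately have law: "a\<^sup>2 + b\<^sup>2 - 2 * a * b * cos \<theta> = c\<^sup>2"
    by (simp add: field_simps power2_sum)
  obtain A B C :: "real^2" where triangle:
    "\<not> collinear {A, B, C}" "dist B C = a" "dist A C = b"
    "(dist A B)\<^sup>2 = a\<^sup>2 + b\<^sup>2 - 2 * a * b * cos \<theta>"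
    "vertex_angle A C B = \<theta>" "triangle_area A B C = n"
    using exists_triangle_two_sides_angle[of a b \<theta>] pos assms by metis
  \<comment> \<open>Both lengths are nonnegative and have the same square.\<close>
  have AB: "dist A B = c"
    using triangle law pos by (simp add: power2_eq_iff_nonneg)
  have rational: "rational_triangle A B C"
    unfolding rational_triangle_def using triangle AB rat by simp
  have "n \<in> \<rat>"
    using n assms by simp
  then have "heron_triangle A B C"
    unfolding heron_triangle_def using rational triangle by simp
  moreover have "tau_congruent \<tau> n"
    unfolding tau_congruent_def using rational triangle assms by metis
  moreover have "cong_mod_squares n (\<tau> * x * y)"
  proof -
    have "n / (\<tau> * x * y) = (1 / \<tau>)\<^sup>2"
      unfolding n using \<open>x > 0\<close> \<open>y > 0\<close> by (simp add: power2_eq_square)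
    moreover have "1 / \<tau> \<in> \<rat>" "1 / \<tau> \<noteq> 0"
      using assms by auto
    moreover have "n \<noteq> 0"
      unfolding n using \<open>x > 0\<close> \<open>y > 0\<close> \<open>\<tau> > 0\<close> by simp
    moreover have "\<tau> * x * y \<in> \<rat>" "\<tau> * x * y \<noteq> 0"
      using assms(4-9) by simp_all
    ultimately show ?thesis
      unfolding cong_mod_squares_def using \<open>n \<in> \<rat>\<close> by blast
  qed
  ultimately show ?thesis
    using triangle AB by blast
qed

end
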